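(* Let $H$ be a connected non-transmission-regular uniform hypergraph of order $n$. (1) If $n$ is odd, then \[ D_{\max}(H)-\lambda_1(H)\geq\frac{n+1-\sqrt{(n-1)(n+3)}}{2}, \] with equality if and only if $\partial(H)\cong K_{1,2,\ldots,2}$ (the complete $r$-partite graph with one part of size $1$ and $r-1$ parts of size $2$, where $n=2r-1$). (2) If $n$ is even, then \[ D_{\max}(H)-\lambda_1(H)\geq\frac{n+2-\sqrt{n^2+4n-4}}{2}, \] with equality if and only if $\partial(H)$ is isomorphic to some $(n-4)$-DVDR graph.
   Context: An $r$-uniform hypergraph $H$ is a family of $r$-element subsets (edges) of a finite vertex set; it is uniform if it is $r$-uniform for some $r$. The shadow graph $\partial(H)$ is the simple graph on the vertex set of $H$ in which two distinct vertices are adjacent iff some edge of $H$ contains both. $H$ is connected iff $\partial(H)$ is connected, and the distance $d(u,v)$ in $H$ is the distance in $\partial(H)$ (the length of a shortest sequence of vertices from $u$ to $v$ in which consecutive vertices lie in a common edge). The distance matrix $D(H)$ has $(u,v)$-entry $d(u,v)$, and $\lambda_1(H)$ is its largest eigenvalue. The transmission of a vertex $v$ is $D_v=\sum_w d(v,w)$; $D_{\max}(H)$, $D_{\min}(H)$ are the maximum and minimum transmissions; $H$ is non-transmission-regular if $D_{\max}(H)\neq D_{\min}(H)$. A connected graph $G$ on $n$ vertices is an $r$-DVDR graph if it has a vertex $v$ of degree $n-1$ such that $G-v$ is $r$-regular. *)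

theory Defs
  imports
    "Jordan_Normal_Form.Char_Poly"
    "Graph_Theory.Graph_Theory"
begin

text \<open>
  Simple graphs are represented as in the Graph\_Theory library: a finite, loop-free, symmetric
  digraph without parallel arcs (\<^locale>\<open>pair_graph\<close>). Every undirected edge is a pair of opposite
  arcs, so the degree of a vertex is its out-degree, and \<^const>\<open>digraph_iso\<close> is graph isomorphism.
\<close>

record 'a hypergraph =
  hverts :: "'a set"
  hedges :: "'a set set"

definition r_uniform :: "nat \<Rightarrow> 'a hypergraph \<Rightarrow> bool" where
  "r_uniform r H \<longleftrightarrow> finite (hverts H) \<and> (\<forall>e\<in>hedges H. e \<subseteq> hverts H \<and> card e = r)"

definition uniform_hypergraph :: "'a hypergraph \<Rightarrow> bool" where
  "uniform_hypergraph H \<longleftrightarrow> (\<exists>r. r_uniform r H)"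

definition horder :: "'a hypergraph \<Rightarrow> nat" where
  "horder H = card (hverts H)"

definition shadow :: "'a hypergraph \<Rightarrow> 'a pair_pre_digraph" where
  "shadow H = \<lparr> pverts = hverts H,
     parcs = {(u, v). u \<in> hverts H \<and> v \<in> hverts H \<and> u \<noteq> v \<and> (\<exists>e\<in>hedges H. u \<in> e \<and> v \<in> e)} \<rparr>"

text \<open>In Graph\_Theory a connected graph is required to have a vertex.\<close>

definition hconnected :: "'a hypergraph \<Rightarrow> bool" where
  "hconnected H \<longleftrightarrow> connected (with_proj (shadow H))"

text \<open>An \<open>awalk\<close> is a list of arcs, so its length is the number of steps.\<close>

definition hdist :: "'a hypergraph \<Rightarrow> 'a \<Rightarrow> 'a \<Rightarrow> nat" where
  "hdist H u v =
     (LEAST k. \<exists>p. pre_digraph.awalk (with_proj (shadow H)) u p v \<and> length p = k)"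

text \<open>
  Matrices of Jordan\_Normal\_Form are indexed by natural numbers, so the vertices have to be
  listed in some order; another order gives a permutation-similar matrix.
\<close>

definition vertex_list :: "'a hypergraph \<Rightarrow> 'a list" where
  "vertex_list H = (SOME xs. distinct xs \<and> set xs = hverts H)"

definition distance_matrix :: "'a hypergraph \<Rightarrow> real mat" where
  "distance_matrix H =
     mat (horder H) (horder H)
       (\<lambda>(i, j). real (hdist H (vertex_list H ! i) (vertex_list H ! j)))"

text \<open>The matrix is real symmetric, so all its eigenvalues are real.\<close>

definition lambda1 :: "'a hypergraph \<Rightarrow> real" where
  "lambda1 H = Max {k. eigenvalue (distance_matrix H) k}"

definition transmission :: "'a hypergraph \<Rightarrow> 'a \<Rightarrow> nat" where
  "transmission H v = (\<Sum>w\<in>hverts H. hdist H v w)"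

definition D_max :: "'a hypergraph \<Rightarrow> nat" where
  "D_max H = Max (transmission H ` hverts H)"

definition D_min :: "'a hypergraph \<Rightarrow> nat" where
  "D_min H = Min (transmission H ` hverts H)"

definition non_transmission_regular :: "'a hypergraph \<Rightarrow> bool" where
  "non_transmission_regular H \<longleftrightarrow> D_max H \<noteq> D_min H"

text \<open>Part \<open>i\<close> is \<open>{(i, k) | k. k < ns ! i}\<close>.\<close>

definition complete_multipartite :: "nat list \<Rightarrow> (nat \<times> nat) pair_pre_digraph" where
  "complete_multipartite ns =
     (let V = {(i, k). i < length ns \<and> k < ns ! i}
      in \<lparr> pverts = V, parcs = {(x, y). x \<in> V \<and> y \<in> V \<and> fst x \<noteq> fst y} \<rparr>)"

definition DVDR :: "nat \<Rightarrow> 'a pair_pre_digraph \<Rightarrow> bool" where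
  "DVDR r G \<longleftrightarrow> pair_graph G \<and> connected (with_proj G) \<and>
     (\<exists>v\<in>pverts G. out_degree (with_proj G) v = card (pverts G) - 1 \<and>
        (\<forall>u\<in>verts (pre_digraph.del_vert (with_proj G) v).
           out_degree (pre_digraph.del_vert (with_proj G) v) u = r))"

end

(* For a function x on the vertices and M = D_max, the quadratic form of M I - D is
   sum_v (M - D_v) x_v^2 + sum_{u,v} d(u,v) (x_u - x_v)^2, the second sum over unordered pairs.
   If M - D_p is at least w > 0, it is bounded below by the form of a star centred at p with weight w
   at p, by dropping all pairs that miss p and using d >= 1. This bound minus mu |x|^2, with mu the
   smaller root of t^2 - (n + w) t + w, is a sum of squares, so M - lambda_1 >= mu. In the equality
   case p is adjacent to all other vertices and all other transmissions equal M = n - 1 + w,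
   i.e. every other vertex has exactly w non-neighbours; conversely such a graph has the eigenvalue
   M - mu. For n odd take w = 1. For n even the sum of the transmissions is even, so either some
   M - D_p is at least 2 (take w = 2), or at least two vertices have M - D_v = 1, and averaging the
   two star bounds for w = 2 gives a strict inequality. *)

theory Submission
  imports Defs "Jordan_Normal_Form.Spectral_Radius"
begin

section \<open>Symmetric real matrices\<close>

lemma eigenvector_index_iff:
  fixes A :: "'a :: comm_ring_1 mat"
  assumes "A \<in> carrier_mat n n" "v \<in> carrier_vec n"
  shows "eigenvector A v k \<longleftrightarrow>
    (\<exists>i<n. v $ i \<noteq> 0) \<and> (\<forall>i<n. (\<Sum>j<n. A $$ (i, j) * v $ j) = k * v $ i)"
proof -
  have "v \<noteq> 0\<^sub>v n \<longleftrightarrow> (\<exists>i<n. v $ i \<noteq> 0)"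
    using assms by (auto simp: vec_eq_iff)
  moreover have "A *\<^sub>v v = k \<cdot>\<^sub>v v \<longleftrightarrow> (\<forall>i<n. (\<Sum>j<n. A $$ (i, j) * v $ j) = k * v $ i)"
    using assms by (auto simp: vec_eq_iff scalar_prod_def lessThan_atLeast0)
  ultimately show ?thesis
    using assms by (auto simp: eigenvector_def)
qed

text \<open>\<open>lambda1\<close> is a \<open>Max\<close>, so the set of real eigenvalues must be
  shown nonempty. Over the complex numbers an eigenvector exists; symmetry forces its eigenvalue to
  be real, and then its real or its imaginary part is a real eigenvector.\<close>

lemma symmetric_real_mat_has_eigenvalue:
  fixes A :: "real mat"
  assumes A: "A \<in> carrier_mat n n" and "n > 0"
    and sym: "\<And>i j. i < n \<Longrightarrow> j < n \<Longrightarrow> A $$ (i, j) = A $$ (j, i)"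
  shows "\<exists>k. eigenvalue A k"
proof -
  let ?B = "map_mat complex_of_real A"
  have B: "?B \<in> carrier_mat n n"
    using A by simp
  obtain z w where "eigenvector ?B w z"
    using spectrum_non_empty[OF B \<open>n > 0\<close>] by (auto simp: spectrum_def eigenvalue_def)
  moreover from this have w: "w \<in> carrier_vec n"
    using A by (simp add: eigenvector_def)
  ultimately have nz: "\<exists>i<n. w $ i \<noteq> 0"
    and eq: "\<And>i. i < n \<Longrightarrow> (\<Sum>j<n. complex_of_real (A $$ (i, j)) * w $ j) = z * w $ i"
    using A by (auto simp: eigenvector_index_iff[OF B])
  define a b where "a i = Re (w $ i)" and "b i = Im (w $ i)" for i
  have Aa: "(\<Sum>j<n. A $$ (i, j) * a j) = Re z * a i - Im z * b i" if "i < n" for i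
    using arg_cong[OF eq[OF that], of Re] by (simp add: a_def b_def)
  have Ab: "(\<Sum>j<n. A $$ (i, j) * b j) = Re z * b i + Im z * a i" if "i < n" for i
    using arg_cong[OF eq[OF that], of Im] by (simp add: a_def b_def)
  \<comment> \<open>By symmetry, pairing \<open>b\<close> with \<open>A a\<close> gives the same
    number as pairing \<open>a\<close> with \<open>A b\<close>. Inserting \<open>Aa\<close> and
    \<open>Ab\<close> cancels \<open>Re z\<close> and leaves \<open>Im z\<close> times the squared
    norm of \<open>w\<close>.\<close>
  have "(\<Sum>i<n. b i * (\<Sum>j<n. A $$ (i, j) * a j)) = (\<Sum>i<n. \<Sum>j<n. A $$ (i, j) * (a j * b i))"
    by (simp add: sum_distrib_left mult_ac)
  also have "\<dots> = (\<Sum>j<n. \<Sum>i<n. A $$ (i, j) * (a j * b i))"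
    by (rule sum.swap)
  also have "\<dots> = (\<Sum>j<n. a j * (\<Sum>i<n. A $$ (j, i) * b i))"
    using sym by (simp add: sum_distrib_left mult_ac)
  finally have "(\<Sum>i<n. b i * (Re z * a i - Im z * b i)) = (\<Sum>j<n. a j * (Re z * b j + Im z * a j))"
    by (simp add: Aa Ab)
  then have "(\<Sum>i<n. Im z * ((a i)\<^sup>2 + (b i)\<^sup>2)) = 0"
    by (simp add: algebra_simps sum.distrib sum_subtractf power2_eq_square)
  then have "Im z * (\<Sum>i<n. (a i)\<^sup>2 + (b i)\<^sup>2) = 0"
    by (simp only: sum_distrib_left)
  moreover have "(\<Sum>i<n. (a i)\<^sup>2 + (b i)\<^sup>2) \<noteq> 0"
  proof -
    obtain i where "i < n" "w $ i \<noteq> 0"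
      using nz by blast
    then have "0 < (\<Sum>i<n. (a i)\<^sup>2 + (b i)\<^sup>2)"
      by (intro sum_pos2[of _ i]) (auto simp: complex_eq_iff a_def b_def sum_power2_gt_zero_iff)
    then show ?thesis
      by linarith
  qed
  ultimately have im: "Im z = 0"
    by simp
  have ev: "eigenvalue A (Re z)" if "\<exists>i<n. c i \<noteq> 0"
    "\<And>i. i < n \<Longrightarrow> (\<Sum>j<n. A $$ (i, j) * c j) = Re z * c i" for c
    unfolding eigenvalue_def
    using that by (intro exI[of _ "vec n c"]) (auto simp: eigenvector_index_iff[OF A])
  \<comment> \<open>Now that \<open>Im z = 0\<close>, \<open>Aa\<close> and \<open>Ab\<close> are
    genuine eigenvalue equations for \<open>a\<close> and \<open>b\<close> separately, and at least
    one of the two is nonzero.\<close>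
  from nz consider "\<exists>i<n. a i \<noteq> 0" | "\<exists>i<n. b i \<noteq> 0"
    by (auto simp: complex_eq_iff a_def b_def)
  then show ?thesis
    using ev[of a] ev[of b] by cases (auto simp: Aa Ab im)
qed

section \<open>The quadratic form of an integer distance\<close>

text \<open>Isolates the properties of \<open>hdist\<close> on which the spectral estimates rest.
  Integrality matters: it makes a positive deficit at least 1 and allows a parity argument.\<close>

locale integer_distance =
  fixes V :: "'a set" and d :: "'a \<Rightarrow> 'a \<Rightarrow> nat"
  assumes finite_V: "finite V"
    and d_self: "v \<in> V \<Longrightarrow> d v v = 0"
    and d_sym: "u \<in> V \<Longrightarrow> v \<in> V \<Longrightarrow> d u v = d v u"
    and d_pos: "u \<in> V \<Longrightarrow> v \<in> V \<Longrightarrow> u \<noteq> v \<Longrightarrow> 1 \<le> d u v"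
begin

definition row_sum :: "'a \<Rightarrow> nat" where
  "row_sum v = (\<Sum>w\<in>V. d v w)"

text \<open>Eigenvectors are functions on the vertices here, so that the estimates are free of any
  ordering; \<open>eigenvalue_distance_matrix_iff\<close> returns to the matrix.\<close>

definition eigenfun :: "real \<Rightarrow> ('a \<Rightarrow> real) \<Rightarrow> bool" where
  "eigenfun k x \<longleftrightarrow> (\<exists>v\<in>V. x v \<noteq> 0) \<and> (\<forall>u\<in>V. (\<Sum>v\<in>V. real (d u v) * x v) = k * x u)"

text \<open>The Laplacian form of the complete graph with weights \<open>d\<close>. The division by
  2 compensates for counting every unordered pair twice.\<close>

definition spread :: "('a \<Rightarrow> real) \<Rightarrow> real" where
  "spread x = (\<Sum>u\<in>V. \<Sum>v\<in>V. real (d u v) * (x u - x v)\<^sup>2) / 2"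

text \<open>A handshake argument: every unordered pair contributes its distance twice and the
  diagonal contributes 0. The induction adds one vertex at a time.\<close>

lemma even_sum_row_sum: "even (\<Sum>v\<in>V. row_sum v)"
proof -
  have "even (\<Sum>u\<in>W. \<Sum>v\<in>W. d u v)" if "W \<subseteq> V" for W
    using finite_subset[OF that finite_V] that
  proof (induction W rule: finite_induct)
    case (insert a W)
    have "(\<Sum>u\<in>W. d u a) = (\<Sum>u\<in>W. d a u)"
      using insert.prems by (intro sum.cong) (auto simp: d_sym)
    then show ?case
      using insert by (simp add: sum.distrib d_self)
  qed simp
  then show ?thesis
    by (simp add: row_sum_def)
qed

lemma sum_squares_pos:
  assumes "eigenfun k x"
  shows "0 < (\<Sum>v\<in>V. (x v)\<^sup>2)"
  using assms finite_V by (auto simp: eigenfun_def intro!: sum_pos2)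

text \<open>Write 2 x_u x_v as x_u^2 + x_v^2 - (x_u - x_v)^2 in the form of the distance matrix: the
  squares collect into row sums and the rest is \<open>spread x\<close>. Later \<open>M\<close> is
  the maximal transmission.\<close>

lemma rayleigh_identity:
  assumes "eigenfun k x"
  shows "(M - k) * (\<Sum>v\<in>V. (x v)\<^sup>2) = (\<Sum>v\<in>V. (M - real (row_sum v)) * (x v)\<^sup>2) + spread x"
proof -
  have D: "(\<Sum>u\<in>V. \<Sum>v\<in>V. real (d u v) * (x u * x v)) = k * (\<Sum>u\<in>V. (x u)\<^sup>2)"
  proof -
    have "(\<Sum>v\<in>V. real (d u v) * (x u * x v)) = k * (x u)\<^sup>2" if "u \<in> V" for u
    proof -
      have "(\<Sum>v\<in>V. real (d u v) * (x u * x v)) = x u * (\<Sum>v\<in>V. real (d u v) * x v)"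
        by (simp add: sum_distrib_left mult_ac)
      then show ?thesis
        using assms that by (simp add: eigenfun_def power2_eq_square)
    qed
    then show ?thesis
      by (simp add: sum_distrib_left)
  qed
  have Tl: "(\<Sum>u\<in>V. \<Sum>v\<in>V. real (d u v) * (x u)\<^sup>2) = (\<Sum>u\<in>V. real (row_sum u) * (x u)\<^sup>2)"
    by (simp add: row_sum_def sum_distrib_right)
  have Tr: "(\<Sum>u\<in>V. \<Sum>v\<in>V. real (d u v) * (x v)\<^sup>2) = (\<Sum>u\<in>V. real (row_sum u) * (x u)\<^sup>2)"
    by (subst sum.swap, subst Tl[symmetric]) (auto intro!: sum.cong simp: d_sym)
  have "2 * spread x = (\<Sum>u\<in>V. \<Sum>v\<in>V. real (d u v) * (x u)\<^sup>2
      + real (d u v) * (x v)\<^sup>2 - 2 * (real (d u v) * (x u * x v)))"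
    by (simp add: spread_def) (intro sum.cong refl; simp add: power2_eq_square algebra_simps)
  also have "\<dots> = (\<Sum>u\<in>V. \<Sum>v\<in>V. real (d u v) * (x u)\<^sup>2)
      + (\<Sum>u\<in>V. \<Sum>v\<in>V. real (d u v) * (x v)\<^sup>2) - 2 * (\<Sum>u\<in>V. \<Sum>v\<in>V. real (d u v) * (x u * x v))"
    by (simp only: sum.distrib sum_subtractf sum_distrib_left[symmetric])
  finally have "2 * spread x = 2 * (\<Sum>u\<in>V. real (row_sum u) * (x u)\<^sup>2) - 2 * (k * (\<Sum>u\<in>V. (x u)\<^sup>2))"
    by (simp only: D Tl Tr)
  moreover have "(\<Sum>v\<in>V. (M - real (row_sum v)) * (x v)\<^sup>2)
      = M * (\<Sum>u\<in>V. (x u)\<^sup>2) - (\<Sum>u\<in>V. real (row_sum u) * (x u)\<^sup>2)"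
    by (simp only: left_diff_distrib sum_subtractf sum_distrib_left[symmetric])
  ultimately show ?thesis
    by (simp add: left_diff_distrib)
qed

section \<open>Comparison with a weighted star\<close>

lemma spread_ge_star:
  assumes "p \<in> V"
  shows "(\<Sum>v\<in>V - {p}. real (d p v) * (x p - x v)\<^sup>2) \<le> spread x"
proof -
  let ?f = "\<lambda>u v. real (d u v) * (x u - x v)\<^sup>2"
  have V: "(\<Sum>v\<in>V. g v) = g p + (\<Sum>v\<in>V - {p}. g v)" for g :: "'a \<Rightarrow> real"
    using assms finite_V by (simp add: sum.remove)
  have "(\<Sum>u\<in>V - {p}. ?f u p) = (\<Sum>u\<in>V - {p}. ?f p u)"
    using assms by (intro sum.cong) (auto simp: d_sym power2_commute)
  \<comment> \<open>The pairs through \<open>p\<close> occur once in each order, which cancels the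
    factor 1/2 in \<open>spread\<close>.\<close>
  then have "2 * spread x = 2 * (\<Sum>v\<in>V - {p}. ?f p v) + (\<Sum>u\<in>V - {p}. \<Sum>v\<in>V - {p}. ?f u v)"
    by (simp add: spread_def V sum.distrib)
  moreover have "0 \<le> (\<Sum>u\<in>V - {p}. \<Sum>v\<in>V - {p}. ?f u v)"
    by (intro sum_nonneg) auto
  ultimately show ?thesis
    by linarith
qed

text \<open>With \<open>m\<close> leaves, \<open>\<mu>\<close> is the least eigenvalue of the Laplacian of a star with an extra weight \<open>w\<close>
  at the centre; its eigenvector has the ratio \<open>1 - \<mu>\<close> between centre and leaves.\<close>

lemma star_square:
  fixes \<mu> w :: real
  assumes "p \<in> V" "\<mu> < 1" "(1 - \<mu>) * (real (card V) - 1 + w - \<mu>) = real (card V) - 1"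
  shows "w * (x p)\<^sup>2 + (\<Sum>v\<in>V - {p}. (x p - x v)\<^sup>2)
    = \<mu> * (\<Sum>v\<in>V. (x v)\<^sup>2) + (1 - \<mu>) * (\<Sum>v\<in>V - {p}. (x v - x p / (1 - \<mu>))\<^sup>2)"
proof -
  let ?m = "real (card V) - 1"
  have c: "real (card (V - {p})) = ?m"
    using card_Suc_Diff1[OF finite_V assms(1)] by linarith
  have V: "(\<Sum>v\<in>V. (x v)\<^sup>2) = (x p)\<^sup>2 + (\<Sum>v\<in>V - {p}. (x v)\<^sup>2)"
    using assms finite_V by (simp add: sum.remove)
  have "(1 - \<mu>) * (\<Sum>v\<in>V - {p}. (x v - x p / (1 - \<mu>))\<^sup>2)
      = (\<Sum>v\<in>V - {p}. (1 - \<mu>) * (x v)\<^sup>2 - 2 * x p * x v + (x p)\<^sup>2 / (1 - \<mu>))"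
    unfolding sum_distrib_left
  proof (intro sum.cong refl)
    fix v
    define y where "y = x p / (1 - \<mu>)"
    have y: "x p = (1 - \<mu>) * y"
      using assms(2) by (simp add: y_def)
    have "(x p)\<^sup>2 / (1 - \<mu>) = (1 - \<mu>) * y\<^sup>2"
      using assms(2) by (simp add: y power2_eq_square)
    moreover have "(1 - \<mu>) * (x v - y)\<^sup>2 = (1 - \<mu>) * (x v)\<^sup>2 - 2 * x p * x v + (1 - \<mu>) * y\<^sup>2"
      by (simp add: y power2_eq_square algebra_simps)
    ultimately show "(1 - \<mu>) * (x v - x p / (1 - \<mu>))\<^sup>2
        = (1 - \<mu>) * (x v)\<^sup>2 - 2 * x p * x v + (x p)\<^sup>2 / (1 - \<mu>)"
      by (simp add: y_def)
  qed
  also have "\<dots> = (1 - \<mu>) * (\<Sum>v\<in>V - {p}. (x v)\<^sup>2) - 2 * x p * (\<Sum>v\<in>V - {p}. x v)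
      + ?m * (x p)\<^sup>2 / (1 - \<mu>)"
    by (simp only: sum.distrib sum_subtractf sum_distrib_left[symmetric] sum_constant c times_divide_eq_right)
  \<comment> \<open>The only use of the quadratic equation for \<mu>: it is the condition under
    which completing the squares at the leaves produces the right coefficient at the centre.\<close>
  also have "?m * (x p)\<^sup>2 / (1 - \<mu>) = (?m + w - \<mu>) * (x p)\<^sup>2"
    using assms(2) by (subst assms(3)[symmetric]) simp
  finally have 1: "(1 - \<mu>) * (\<Sum>v\<in>V - {p}. (x v - x p / (1 - \<mu>))\<^sup>2)
      = (1 - \<mu>) * (\<Sum>v\<in>V - {p}. (x v)\<^sup>2) - 2 * x p * (\<Sum>v\<in>V - {p}. x v) + (?m + w - \<mu>) * (x p)\<^sup>2" .
  have 2: "(\<Sum>v\<in>V - {p}. (x p - x v)\<^sup>2)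
      = ?m * (x p)\<^sup>2 - 2 * x p * (\<Sum>v\<in>V - {p}. x v) + (\<Sum>v\<in>V - {p}. (x v)\<^sup>2)"
    by (simp only: power2_diff sum.distrib sum_subtractf sum_distrib_left[symmetric] sum_constant c)
  show ?thesis
    unfolding V 1 2 by (simp add: algebra_simps)
qed

text \<open>Each distance from \<open>p\<close> is split as 1 plus an excess. Both slack sums on the
  left are nonnegative; they are retained because their vanishing describes the equality
  case.\<close>

lemma star_bound:
  fixes \<mu> w :: real
  assumes "p \<in> V" "\<mu> < 1" "(1 - \<mu>) * (real (card V) - 1 + w - \<mu>) = real (card V) - 1"
  shows "\<mu> * (\<Sum>v\<in>V. (x v)\<^sup>2) + (1 - \<mu>) * (\<Sum>v\<in>V - {p}. (x v - x p / (1 - \<mu>))\<^sup>2)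
      + (\<Sum>v\<in>V - {p}. (real (d p v) - 1) * (x p - x v)\<^sup>2) \<le> w * (x p)\<^sup>2 + spread x"
  using star_square[OF assms, of x] spread_ge_star[OF assms(1), of x]
  by (simp add: left_diff_distrib sum_subtractf)

text \<open>Four nonnegative slacks separate the two sides: \<open>A\<close> measures how far
  \<open>x\<close> is from the extremal vector of the star, \<open>B\<close> the distances from
  \<open>p\<close> beyond 1, \<open>C\<close> the deficits of the other vertices, and
  \<open>E\<close> the deficit of \<open>p\<close> beyond \<open>w\<close>. Equality makes all four
  vanish. Then \<open>A = 0\<close> determines \<open>x\<close> up to scaling, and this
  \<open>x\<close> is such that \<open>B\<close>, \<open>C\<close> and \<open>E\<close> can vanish
  only if their coefficients do.\<close>

lemma gap_bound:
  fixes \<mu> :: real and w M :: nat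
  assumes "p \<in> V" "\<mu> < 1" "(1 - \<mu>) * (real (card V) - 1 + real w - \<mu>) = real (card V) - 1"
    and "eigenfun k x" and p: "row_sum p + w \<le> M" and M: "\<forall>v\<in>V. row_sum v \<le> M"
  shows "\<mu> \<le> real M - k"
    and "0 < \<mu> \<Longrightarrow> real M - k = \<mu> \<Longrightarrow>
      row_sum p + w = M \<and> (\<forall>v\<in>V - {p}. d p v = 1 \<and> row_sum v = M)"
proof -
  let ?N = "\<Sum>v\<in>V. (x v)\<^sup>2"
  define A where "A = (1 - \<mu>) * (\<Sum>v\<in>V - {p}. (x v - x p / (1 - \<mu>))\<^sup>2)"
  define B where "B = (\<Sum>v\<in>V - {p}. (real (d p v) - 1) * (x p - x v)\<^sup>2)"
  define C where "C = (\<Sum>v\<in>V - {p}. (real M - real (row_sum v)) * (x v)\<^sup>2)"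
  define E where "E = (real M - real (row_sum p) - real w) * (x p)\<^sup>2"
  have dp: "1 \<le> d p v" if "v \<in> V - {p}" for v
    using that d_pos[OF assms(1), of v] by auto
  have nn: "0 \<le> A" "0 \<le> B" "0 \<le> C" "0 \<le> E"
    unfolding A_def B_def C_def E_def using assms dp
    by (auto intro!: sum_nonneg mult_nonneg_nonneg)
  have "(real M - k) * ?N = C + E + real w * (x p)\<^sup>2 + spread x"
    unfolding rayleigh_identity[OF assms(4)] C_def E_def
    using assms(1) finite_V by (subst sum.remove[of _ p]) (auto simp: algebra_simps)
  then have le: "\<mu> * ?N + (A + B + C + E) \<le> (real M - k) * ?N"
    using star_bound[OF assms(1-3), of x] unfolding A_def B_def by simp
  have N: "0 < ?N"
    using assms(4) by (rule sum_squares_pos)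
  have "\<mu> * ?N \<le> (real M - k) * ?N"
    using le nn by linarith
  with N show "\<mu> \<le> real M - k"
    by simp
  assume "0 < \<mu>" "real M - k = \<mu>"
  with le nn have zero: "A = 0" "B = 0" "C = 0" "E = 0"
    by auto
  have fin: "finite (V - {p})"
    using finite_V by simp
  have leaf: "x v = x p / (1 - \<mu>)" if "v \<in> V - {p}" for v
  proof -
    have "(\<Sum>v\<in>V - {p}. (x v - x p / (1 - \<mu>))\<^sup>2) = 0"
      using zero(1) assms(2) by (simp add: A_def)
    then have "(x v - x p / (1 - \<mu>))\<^sup>2 = 0"
      by (subst (asm) sum_nonneg_eq_0_iff[OF fin]) (use that in auto)
    then show ?thesis
      by simp
  qed
  have xp: "x p \<noteq> 0"
  proof
    assume "x p = 0"
    then have "x v = 0" if "v \<in> V" for v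
      using leaf[of v] that by (cases "v = p") auto
    with assms(4) show False
      by (auto simp: eigenfun_def)
  qed
  \<comment> \<open>As \<open>1 - \<mu>\<close> lies strictly between 0 and 1, the leaf value is
    nonzero and differs from the value at \<open>p\<close>. These are the factors to be cancelled in
    \<open>B\<close> and \<open>C\<close>.\<close>
  have neq: "x v \<noteq> 0" "x p \<noteq> x v" if "v \<in> V - {p}" for v
    using leaf[OF that] xp \<open>0 < \<mu>\<close> assms(2) by (auto simp: field_simps)
  have "row_sum p + w = M"
    using zero(4) xp by (auto simp: E_def)
  moreover have "d p v = 1 \<and> row_sum v = M" if v: "v \<in> V - {p}" for v
  proof -
    have "(real (d p v) - 1) * (x p - x v)\<^sup>2 = 0"
      using zero(2) unfolding B_def
      by (subst (asm) sum_nonneg_eq_0_iff[OF fin]) (use v dp in \<open>auto intro!: mult_nonneg_nonneg\<close>)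
    moreover have "(real M - real (row_sum v)) * (x v)\<^sup>2 = 0"
      using zero(3) unfolding C_def
      by (subst (asm) sum_nonneg_eq_0_iff[OF fin]) (use v M in \<open>auto intro!: mult_nonneg_nonneg\<close>)
    ultimately show ?thesis
      using neq[OF v] by auto
  qed
  ultimately show "row_sum p + w = M \<and> (\<forall>v\<in>V - {p}. d p v = 1 \<and> row_sum v = M)"
    by blast
qed

text \<open>For two deficient vertices, average the bounds of weight 2 at either vertex; both cannot be tight,
  as each extremal vector is strictly smaller at its own centre.\<close>

lemma gap_bound_two:
  fixes \<mu> :: real and M :: nat
  assumes "p \<in> V" "q \<in> V" "p \<noteq> q" "0 < \<mu>" "\<mu> < 1"
    and \<mu>: "(1 - \<mu>) * (real (card V) - 1 + 2 - \<mu>) = real (card V) - 1"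
    and "eigenfun k x" and "row_sum p < M" "row_sum q < M" and M: "\<forall>v\<in>V. row_sum v \<le> M"
  shows "\<mu> < real M - k"
proof (rule ccontr)
  assume not: "\<not> \<mu> < real M - k"
  let ?N = "\<Sum>v\<in>V. (x v)\<^sup>2"
  define A where "A r = (\<Sum>v\<in>V - {r}. (x v - x r / (1 - \<mu>))\<^sup>2)" for r
  have fin: "finite (V - {r})" for r
    using finite_V by simp
  have A0: "0 \<le> A r" for r
    by (auto simp: A_def intro: sum_nonneg)
  have bound: "\<mu> * ?N + (1 - \<mu>) * A r \<le> 2 * (x r)\<^sup>2 + spread x" if "r \<in> V" for r
  proof -
    have "0 \<le> (\<Sum>v\<in>V - {r}. (real (d r v) - 1) * (x r - x v)\<^sup>2)"
      using d_pos[OF that] by (fastforce intro!: sum_nonneg mult_nonneg_nonneg)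
    then show ?thesis
      using star_bound[OF that assms(5) \<mu>, of x] unfolding A_def by linarith
  qed
  \<comment> \<open>The deficits of \<open>p\<close> and \<open>q\<close> are positive integers,
    hence at least 1; all other deficits are nonnegative.\<close>
  have "(x p)\<^sup>2 + (x q)\<^sup>2 = (\<Sum>v\<in>{p, q}. 1 * (x v)\<^sup>2)"
    using assms by simp
  also have "\<dots> \<le> (\<Sum>v\<in>{p, q}. (real M - real (row_sum v)) * (x v)\<^sup>2)"
    using assms by (intro sum_mono mult_right_mono) auto
  also have "\<dots> \<le> (\<Sum>v\<in>V. (real M - real (row_sum v)) * (x v)\<^sup>2)"
    using assms finite_V by (intro sum_mono2) auto
  finally have "(x p)\<^sup>2 + (x q)\<^sup>2 + spread x \<le> (real M - k) * ?N"
    using rayleigh_identity[OF assms(7), of "real M"] by simp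
  moreover have "(real M - k) * ?N \<le> \<mu> * ?N"
    using not sum_squares_pos[OF assms(7)] by (intro mult_right_mono) auto
  \<comment> \<open>Adding the instances of \<open>bound\<close> at \<open>p\<close> and
    \<open>q\<close> gives twice the quantity just bounded, so no room is left for the two
    slacks.\<close>
  ultimately have "(1 - \<mu>) * A p + (1 - \<mu>) * A q \<le> 0"
    using bound[OF assms(1)] bound[OF assms(2)] by linarith
  then have "(1 - \<mu>) * (A p + A q) \<le> 0"
    by (simp add: distrib_left)
  then have "A p + A q \<le> 0"
    using assms(5) by (simp add: mult_le_0_iff)
  then have "A p = 0" "A q = 0"
    using A0[of p] A0[of q] by auto
  then have P: "\<forall>v\<in>V - {p}. x v = x p / (1 - \<mu>)" and Q: "\<forall>v\<in>V - {q}. x v = x q / (1 - \<mu>)"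
    by (simp_all add: A_def sum_nonneg_eq_0_iff[OF fin])
  \<comment> \<open>Each of \<open>x p\<close> and \<open>x q\<close> is the other one multiplied by
    \<open>1 - \<mu>\<close>. Since the square of this factor is below 1, both are 0 and
    \<open>x\<close> vanishes.\<close>
  from P assms have "x q = x p / (1 - \<mu>)"
    by blast
  then have qp: "x q * (1 - \<mu>) = x p"
    using assms(5) by (simp add: eq_divide_eq)
  from Q assms have "x p = x q / (1 - \<mu>)"
    by blast
  then have "x p * (1 - \<mu>) = x q"
    using assms(5) by (simp add: eq_divide_eq)
  with qp have "x p * ((1 - \<mu>) * (1 - \<mu>)) = x p * 1"
    by (metis mult.assoc mult.right_neutral)
  moreover have "(1 - \<mu>) * (1 - \<mu>) < 1 * 1"
    using assms by (intro mult_strict_mono) auto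
  ultimately have "x p = 0"
    by auto
  then have "x v = 0" if "v \<in> V" for v
    using P that by (cases "v = p") auto
  with assms(7) show False
    by (auto simp: eigenfun_def)
qed

text \<open>The extremal vector of the star is an eigenvector of the whole matrix. Row
  \<open>p\<close> gives n - 1, which is the required value by the quadratic equation; any other row
  \<open>u\<close> gives \<open>row_sum u - \<mu>\<close>, as its entry at \<open>p\<close> is
  1.\<close>

lemma eigenfun_star:
  fixes \<mu> :: real and w :: nat
  assumes "p \<in> V" "\<mu> < 1" "(1 - \<mu>) * (real (card V) - 1 + real w - \<mu>) = real (card V) - 1"
    and p: "\<forall>v\<in>V - {p}. d p v = 1"
    and M: "\<forall>v\<in>V - {p}. row_sum v = card V - 1 + w"
  shows "eigenfun (real (card V) - 1 + real w - \<mu>) (\<lambda>v. if v = p then 1 - \<mu> else 1)"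
proof -
  let ?x = "\<lambda>v. if v = p then 1 - \<mu> else 1"
  have c: "real (card V - 1) = real (card V) - 1"
    using card_Suc_Diff1[OF finite_V assms(1)] by linarith
  have V: "(\<Sum>v\<in>V. g v) = g p + (\<Sum>v\<in>V - {p}. g v)" for g :: "'a \<Rightarrow> real"
    using assms finite_V by (simp add: sum.remove)
  have "(\<Sum>v\<in>V. real (d u v) * ?x v) = (real (card V) - 1 + real w - \<mu>) * ?x u" if "u \<in> V" for u
  proof (cases "u = p")
    case True
    have "(\<Sum>v\<in>V. real (d p v) * ?x v) = (\<Sum>v\<in>V - {p}. 1)"
      unfolding V using p d_self[OF assms(1)] by (auto intro!: sum.cong)
    also have "\<dots> = real (card V) - 1"
      using assms(1) finite_V c by simp
    finally show ?thesis
      using True assms(3) by (simp add: mult.commute)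
  next
    case False
    have "(\<Sum>v\<in>V. real (d u v) * ?x v) = real (d u p) * (1 - \<mu>) + (\<Sum>v\<in>V - {p}. real (d u v))"
      unfolding V by simp
    also have "\<dots> = real (row_sum u) - \<mu> * real (d u p)"
      by (simp add: row_sum_def V algebra_simps)
    finally show ?thesis
      using False that M p d_sym[OF that assms(1)] c by simp
  qed
  then show ?thesis
    using assms(1,2) by (auto simp: eigenfun_def intro!: bexI[of _ p])
qed

end

section \<open>Cones over regular graphs\<close>

text \<open>Common form of both equality cases: \<open>c = 1\<close> yields K_{1,2,...,2} and
  \<open>c = 2\<close> the (n-4)-DVDR graphs. Non-neighbours are counted instead of degrees because
  they are what a transmission exceeds n - 1 by in such a graph.\<close>

definition coregular_cone :: "nat \<Rightarrow> 'a pair_pre_digraph \<Rightarrow> bool" where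
  "coregular_cone c G \<longleftrightarrow> (\<exists>p\<in>pverts G. (\<forall>v\<in>pverts G - {p}. (p, v) \<in> parcs G) \<and>
     (\<forall>u\<in>pverts G - {p}. card {w \<in> pverts G. w \<noteq> u \<and> (u, w) \<notin> parcs G} = c))"

text \<open>A library isomorphism also carries a map on arcs and the new head and tail functions.
  For pair digraphs these are forced by the vertex map, so adjacency in both directions
  suffices.\<close>

lemma digraph_iso_with_proj_iff:
  assumes "pair_wf_digraph A" "pair_wf_digraph B"
  shows "digraph_iso (with_proj A) (with_proj B) \<longleftrightarrow>
    (\<exists>f. bij_betw f (pverts A) (pverts B) \<and>
      (\<forall>u\<in>pverts A. \<forall>v\<in>pverts A. (u, v) \<in> parcs A \<longleftrightarrow> (f u, f v) \<in> parcs B))"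
proof
  interpret A: pair_wf_digraph A by fact
  assume "digraph_iso (with_proj A) (with_proj B)"
  then obtain h where h: "pre_digraph.digraph_isomorphism (with_proj A) h"
    and B: "with_proj B = app_iso h (with_proj A)"
    by (auto simp: digraph_iso_def)
  let ?f = "iso_verts h"
  have "pverts B = ?f ` pverts A" and arcs: "parcs B = iso_arcs h ` parcs A"
    and ends: "iso_tail h = fst" "iso_head h = snd"
    using arg_cong[OF B, of verts] arg_cong[OF B, of arcs]
      arg_cong[OF B, of tail] arg_cong[OF B, of head] by (auto simp: app_iso_def)
  moreover have inj: "inj_on ?f (pverts A)"
    using h by (simp add: pre_digraph.digraph_isomorphism_def)
  moreover have iso_arcs: "iso_arcs h a = (?f (fst a), ?f (snd a))" if "a \<in> parcs A" for a
    using h that unfolding pre_digraph.digraph_isomorphism_def ends by (auto simp: prod_eq_iff)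
  have "(u, v) \<in> parcs A \<longleftrightarrow> (?f u, ?f v) \<in> parcs B" if "u \<in> pverts A" "v \<in> pverts A" for u v
  proof
    assume "(u, v) \<in> parcs A"
    then show "(?f u, ?f v) \<in> parcs B"
      unfolding arcs using iso_arcs[of "(u, v)"] by (intro image_eqI) auto
  next
    assume "(?f u, ?f v) \<in> parcs B"
    then obtain a where a: "a \<in> parcs A" "?f u = ?f (fst a)" "?f v = ?f (snd a)"
      unfolding arcs using iso_arcs by auto
    then have "u = fst a" "v = snd a"
      using inj_onD[OF inj] that A.arc_fst_in_verts A.arc_snd_in_verts by blast+
    with a(1) show "(u, v) \<in> parcs A"
      by simp
  qed
  ultimately show "\<exists>f. bij_betw f (pverts A) (pverts B) \<and>
      (\<forall>u\<in>pverts A. \<forall>v\<in>pverts A. (u, v) \<in> parcs A \<longleftrightarrow> (f u, f v) \<in> parcs B)"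
    by (auto simp: bij_betw_def)
next
  interpret A: pair_wf_digraph A by fact
  interpret B: pair_wf_digraph B by fact
  assume "\<exists>f. bij_betw f (pverts A) (pverts B) \<and>
      (\<forall>u\<in>pverts A. \<forall>v\<in>pverts A. (u, v) \<in> parcs A \<longleftrightarrow> (f u, f v) \<in> parcs B)"
  then obtain f where f: "bij_betw f (pverts A) (pverts B)"
    and adj: "\<And>u v. u \<in> pverts A \<Longrightarrow> v \<in> pverts A \<Longrightarrow> (u, v) \<in> parcs A \<longleftrightarrow> (f u, f v) \<in> parcs B"
    by blast
  have inj: "inj_on f (pverts A)" and im: "f ` pverts A = pverts B"
    using f by (auto simp: bij_betw_def)
  \<comment> \<open>Keeping \<open>fst\<close> and \<open>snd\<close> as tail and head makes the
    image under \<open>app_iso\<close> literally \<open>with_proj B\<close>.\<close>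
  let ?h = "\<lparr>iso_verts = f, iso_arcs = map_prod f f, iso_head = snd, iso_tail = fst\<rparr>"
  have sub: "parcs A \<subseteq> pverts A \<times> pverts A"
    using A.in_arcsD1 A.in_arcsD2 by auto
  have "inj_on (map_prod f f) (pverts A \<times> pverts A)"
    using inj inj by (rule map_prod_inj_on)
  then have "inj_on (map_prod f f) (parcs A)"
    using sub by (rule inj_on_subset)
  then have "pre_digraph.digraph_isomorphism (with_proj A) ?h"
    using inj by (simp add: pre_digraph.digraph_isomorphism_def A.wf_digraph_axioms)
  moreover have "map_prod f f ` parcs A = parcs B"
  proof (intro equalityI subsetI)
    fix e assume "e \<in> map_prod f f ` parcs A"
    then show "e \<in> parcs B"
      using adj sub by auto
  next
    fix e assume e: "e \<in> parcs B"
    then have "fst e \<in> f ` pverts A" "snd e \<in> f ` pverts A"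
      unfolding im by (auto intro: B.arc_fst_in_verts B.arc_snd_in_verts)
    then obtain u v where uv: "u \<in> pverts A" "v \<in> pverts A" "e = (f u, f v)"
      by (metis imageE prod.collapse)
    then have "(u, v) \<in> parcs A"
      using adj e by simp
    then show "e \<in> map_prod f f ` parcs A"
      using uv(3) by (intro image_eqI) auto
  qed
  then have "with_proj B = app_iso ?h (with_proj A)"
    by (simp add: with_proj_def app_iso_def im)
  ultimately show "digraph_iso (with_proj A) (with_proj B)"
    unfolding digraph_iso_def by blast
qed

lemma coregular_cone_iso_imp:
  assumes wf: "pair_wf_digraph A" "pair_wf_digraph B"
    and "digraph_iso (with_proj A) (with_proj B)" "coregular_cone c A"
  shows "coregular_cone c B"
proof -
  obtain f where f: "bij_betw f (pverts A) (pverts B)"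
    and adj: "\<And>u v. u \<in> pverts A \<Longrightarrow> v \<in> pverts A \<Longrightarrow> (u, v) \<in> parcs A \<longleftrightarrow> (f u, f v) \<in> parcs B"
    using digraph_iso_with_proj_iff[OF wf] assms(3) by blast
  have inj: "inj_on f (pverts A)" and im: "pverts B = f ` pverts A"
    using f by (auto simp: bij_betw_def)
  obtain p where p: "p \<in> pverts A" "\<forall>v\<in>pverts A - {p}. (p, v) \<in> parcs A"
    "\<forall>u\<in>pverts A - {p}. card {w \<in> pverts A. w \<noteq> u \<and> (u, w) \<notin> parcs A} = c"
    using assms(4) by (auto simp: coregular_cone_def)
  show ?thesis
    unfolding coregular_cone_def
  proof (intro bexI[of _ "f p"] conjI ballI)
    show "f p \<in> pverts B"
      using p(1) im by simp
    show "(f p, y) \<in> parcs B" if "y \<in> pverts B - {f p}" for y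
      using that p adj unfolding im by auto
    show "card {w \<in> pverts B. w \<noteq> y \<and> (y, w) \<notin> parcs B} = c" if y: "y \<in> pverts B - {f p}" for y
    proof -
      obtain u where u: "u \<in> pverts A - {p}" "y = f u"
        using y unfolding im by auto
      have "{w \<in> pverts B. w \<noteq> y \<and> (y, w) \<notin> parcs B} = f ` {w \<in> pverts A. w \<noteq> u \<and> (u, w) \<notin> parcs A}"
        using u adj inj unfolding im by (auto simp: inj_on_def)
      also have "card \<dots> = card {w \<in> pverts A. w \<noteq> u \<and> (u, w) \<notin> parcs A}"
        by (rule card_image) (rule inj_on_subset[OF inj], auto)
      finally show ?thesis
        using p(3) u(1) by simp
    qed
  qed
qed

lemma coregular_cone_iso_iff:
  assumes "pair_wf_digraph A" "pair_wf_digraph B" "digraph_iso (with_proj A) (with_proj B)"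
  shows "coregular_cone c A \<longleftrightarrow> coregular_cone c B"
  using assms coregular_cone_iso_imp digraph_iso_swap wf_digraph_wp_iff by metis

section \<open>The cone over the cocktail party graph, extremal in odd order\<close>

definition cocktail_cone :: "nat \<Rightarrow> (nat \<times> nat) pair_pre_digraph" where
  "cocktail_cone m = complete_multipartite (1 # replicate m 2)"

lemma pverts_cocktail_cone: "pverts (cocktail_cone m) = insert (0, 0) ({1..m} \<times> {0, 1})"
  by (auto simp: cocktail_cone_def complete_multipartite_def nth_Cons' split: if_splits)

lemma parcs_cocktail_cone: "parcs (cocktail_cone m) =
    {(x, y). x \<in> pverts (cocktail_cone m) \<and> y \<in> pverts (cocktail_cone m) \<and> fst x \<noteq> fst y}"
  by (simp add: cocktail_cone_def complete_multipartite_def)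

lemma pair_wf_cocktail_cone: "pair_wf_digraph (cocktail_cone m)"
  by unfold_locales (auto simp: parcs_cocktail_cone)

lemma cone_cocktail_cone: "coregular_cone 1 (cocktail_cone m)"
  unfolding coregular_cone_def
proof (intro bexI[of _ "(0, 0)"] conjI ballI)
  show "(0, 0) \<in> pverts (cocktail_cone m)"
    by (simp add: pverts_cocktail_cone)
  show "((0, 0), v) \<in> parcs (cocktail_cone m)" if "v \<in> pverts (cocktail_cone m) - {(0, 0)}" for v
    using that by (auto simp: parcs_cocktail_cone pverts_cocktail_cone)
  show "card {w \<in> pverts (cocktail_cone m). w \<noteq> u \<and> (u, w) \<notin> parcs (cocktail_cone m)} = 1"
    if u: "u \<in> pverts (cocktail_cone m) - {(0, 0)}" for u
  proof -
    \<comment> \<open>The one non-neighbour is the other vertex of the same part;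
      \<open>1 - snd u\<close> exchanges 0 and 1.\<close>
    have "{w \<in> pverts (cocktail_cone m). w \<noteq> u \<and> (u, w) \<notin> parcs (cocktail_cone m)} = {(fst u, 1 - snd u)}"
      using u by (auto simp: parcs_cocktail_cone pverts_cocktail_cone)
    then show ?thesis
      by simp
  qed
qed

text \<open>Sending each vertex other than the apex to its unique non-neighbour is an involution
  \<open>q\<close> without fixed points. Its orbits are the parts of size 2.\<close>

lemma cone_1_iso_cocktail_cone:
  fixes G :: "'a pair_pre_digraph"
  assumes G: "pair_graph G" and "coregular_cone 1 G"
  shows "\<exists>m. card (pverts G) = 2 * m + 1 \<and> digraph_iso (with_proj G) (with_proj (cocktail_cone m))"
proof -
  interpret G: pair_graph G by fact
  let ?V = "pverts G" and ?E = "parcs G"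
  obtain p where p: "p \<in> ?V" "\<And>v. v \<in> ?V - {p} \<Longrightarrow> (p, v) \<in> ?E"
    "\<And>u. u \<in> ?V - {p} \<Longrightarrow> card {w \<in> ?V. w \<noteq> u \<and> (u, w) \<notin> ?E} = 1"
    using assms(2) unfolding coregular_cone_def by blast
  define q where "q u = the_elem {w \<in> ?V. w \<noteq> u \<and> (u, w) \<notin> ?E}" for u
  have q: "{w \<in> ?V. w \<noteq> u \<and> (u, w) \<notin> ?E} = {q u}" if "u \<in> ?V - {p}" for u
    using p(3)[OF that] by (elim card_1_singletonE) (simp add: q_def)
  have nadj: "(u, w) \<notin> ?E \<longleftrightarrow> w = u \<or> w = q u" if "u \<in> ?V - {p}" "w \<in> ?V" for u w
    using q[OF that(1)] that(2) G.no_loops' by auto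
  have q_V: "q u \<in> ?V - {p}" and q_ne: "q u \<noteq> u" if u: "u \<in> ?V - {p}" for u
  proof -
    have *: "q u \<in> ?V" "q u \<noteq> u" "(u, q u) \<notin> ?E"
      using q[OF u] by auto
    moreover have "q u \<noteq> p"
      using *(3) p(2)[OF u] G.arcs_symmetric by blast
    ultimately show "q u \<in> ?V - {p}" "q u \<noteq> u"
      by auto
  qed
  have q_q: "q (q u) = u" if u: "u \<in> ?V - {p}" for u
  proof -
    have "(q u, u) \<notin> ?E"
      using nadj[OF u] q_V[OF u] G.arcs_symmetric by blast
    then show ?thesis
      using nadj[OF q_V[OF u], of u] q_ne[OF u] u by auto
  qed
  \<comment> \<open>An injection into the naturals orders the vertices, so that \<open>L\<close> can
    select the smaller element of every orbit of \<open>q\<close>.\<close>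
  obtain h :: "'a \<Rightarrow> nat" where h: "inj_on h ?V"
    using finite_imp_inj_to_nat_seg[OF G.pair_finite_verts] by metis
  define L where "L = {u \<in> ?V - {p}. h u < h (q u)}"
  have "finite L"
    using G.pair_finite_verts by (simp add: L_def)
  define m where "m = card L"
  have "\<exists>g. bij_betw g L {1..m}"
    by (rule finite_same_card_bij) (simp_all add: \<open>finite L\<close> m_def)
  then obtain g where g: "bij_betw g L {1..m}" ..
  have swap: "q u \<in> L \<longleftrightarrow> u \<notin> L" if u: "u \<in> ?V - {p}" for u
  proof -
    have "h u \<noteq> h (q u)"
      using q_V[OF u] q_ne[OF u] u inj_onD[OF h, of u "q u"] by auto
    then show ?thesis
      using q_V[OF u] q_q[OF u] u by (auto simp: L_def)
  qed
  \<comment> \<open>Representatives get second coordinate 0 and their partners 1, with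
    \<open>g\<close> numbering the orbits from 1. The number 0 remains for the apex.\<close>
  define f :: "'a \<Rightarrow> nat \<times> nat"
    where "f u = (if u = p then (0, 0) else if u \<in> L then (g u, 0) else (g (q u), 1))" for u
  have g_in: "g u \<in> {1..m}" if "u \<in> L" for u
    using g that by (auto simp: bij_betw_def)
  have g_inj: "g u = g v \<longleftrightarrow> u = v" if "u \<in> L" "v \<in> L" for u v
    using g that by (auto simp: bij_betw_def inj_on_def)
  have LV: "L \<subseteq> ?V - {p}"
    by (auto simp: L_def)
  \<comment> \<open>Equal first coordinates mean the same orbit of \<open>q\<close>, which by
    \<open>nadj\<close> is the same as non-adjacency.\<close>
  have part: "fst (f u) = fst (f v) \<longleftrightarrow> v = u \<or> v = q u" if u: "u \<in> ?V - {p}" and v: "v \<in> ?V - {p}" for u v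
  proof -
    have f: "f w = (if w \<in> L then (g w, 0) else (g (q w), 1))" if "w \<in> ?V - {p}" for w
      using that by (simp add: f_def)
    have qv: "u = q v \<longleftrightarrow> v = q u"
      using q_q[OF u] q_q[OF v] by metis
    have qq: "q u = q v \<longleftrightarrow> v = u"
      using q_q[OF u] q_q[OF v] by metis
    show ?thesis
    proof (cases "u \<in> L")
      case True
      note uL = this
      show ?thesis
      proof (cases "v \<in> L")
        case True
        then have "v \<noteq> q u"
          using uL swap[OF u] by blast
        with True uL show ?thesis
          using g_inj[of u v] by (auto simp: f[OF u] f[OF v])
      next
        case False
        then have "q v \<in> L" "v \<noteq> u"
          using uL swap[OF v] by blast+
        with False uL show ?thesis
          using g_inj[of u "q v"] qv by (simp add: f[OF u] f[OF v])
      qed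
    next
      case False
      then have uL: "u \<notin> L" "q u \<in> L"
        using swap[OF u] by blast+
      show ?thesis
      proof (cases "v \<in> L")
        case True
        then have "v \<noteq> u"
          using uL by blast
        with True uL show ?thesis
          using g_inj[of "q u" v] by (auto simp: f[OF u] f[OF v])
      next
        case False
        then have "q v \<in> L" "v \<noteq> q u"
          using uL swap[OF v] by blast+
        with False uL show ?thesis
          using g_inj[of "q u" "q v"] qq by (simp add: f[OF u] f[OF v])
      qed
    qed
  qed
  have f_V: "f u \<in> {1..m} \<times> {0, 1}" if u: "u \<in> ?V - {p}" for u
    using u swap[OF u] g_in by (auto simp: f_def)
  have bij: "bij_betw f ?V (pverts (cocktail_cone m))"
  proof (rule bij_betw_imageI)
    show "inj_on f ?V"
    proof (rule inj_onI)
      fix u v assume uv: "u \<in> ?V" "v \<in> ?V" "f u = f v"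
      show "u = v"
      proof (cases "u = p \<or> v = p")
        case True
        with uv f_V[of u] f_V[of v] show ?thesis
          by (cases "u = p"; cases "v = p") (auto simp: f_def[of p])
      next
        case False
        then have "v = u \<or> v = q u"
          using part[of u v] uv by auto
        \<comment> \<open>Exactly one element of an orbit lies in \<open>L\<close>, so the second
          coordinates differ.\<close>
        moreover have "f (q u) \<noteq> f u"
          using False uv swap[of u] q_V[of u] by (auto simp: f_def)
        ultimately show ?thesis
          using uv(3) by auto
      qed
    qed
    show "f ` ?V = pverts (cocktail_cone m)"
    proof (intro equalityI subsetI)
      fix y assume "y \<in> f ` ?V"
      then obtain u where u: "u \<in> ?V" "y = f u"
        by blast
      then show "y \<in> pverts (cocktail_cone m)"
        using f_V[of u] unfolding pverts_cocktail_cone by (cases "u = p") (auto simp: f_def[of p])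
    next
      fix y assume y: "y \<in> pverts (cocktail_cone m)"
      show "y \<in> f ` ?V"
      proof (cases "y = (0, 0)")
        case True
        then show ?thesis
          using p(1) by (intro image_eqI[of _ _ p]) (auto simp: f_def)
      next
        case False
        then obtain i k where ik: "y = (i, k)" "i \<in> {1..m}" "k = 0 \<or> k = 1"
          using y unfolding pverts_cocktail_cone by auto
        then have "i \<in> g ` L"
          by (simp only: bij_betw_imp_surj_on[OF g])
        then obtain u where u: "u \<in> L" "g u = i"
          by (rule imageE) simp
        then have uV: "u \<in> ?V - {p}"
          using LV by blast
        have "f u = (i, 0)" "f (q u) = (i, 1)"
          using u uV swap[OF uV] q_V[OF uV] q_q[OF uV] by (auto simp: f_def)
        then show ?thesis
          using ik uV q_V[OF uV] by (metis DiffD1 image_eqI)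
      qed
    qed
  qed
  have "(u, v) \<in> ?E \<longleftrightarrow> (f u, f v) \<in> parcs (cocktail_cone m)" if uv: "u \<in> ?V" "v \<in> ?V" for u v
  proof -
    have fuv: "f u \<in> pverts (cocktail_cone m)" "f v \<in> pverts (cocktail_cone m)"
      using bij uv by (auto simp: bij_betw_def)
    have fp: "f p = (0, 0)"
      by (simp add: f_def)
    have "(u, v) \<in> ?E \<longleftrightarrow> fst (f u) \<noteq> fst (f v)"
    proof (cases "u = p")
      case True
      then show ?thesis
        using uv p(2)[of v] f_V[of v] G.no_loops' fp by (cases "v = p") auto
    next
      case u: False
      show ?thesis
      proof (cases "v = p")
        case True
        then show ?thesis
          using u uv p(2)[of u] f_V[of u] G.arcs_symmetric fp by auto
      next
        case False
        then show ?thesis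
          using u uv nadj[of u v] part[of u v] by auto
      qed
    qed
    then show ?thesis
      using fuv by (simp add: parcs_cocktail_cone)
  qed
  then have "digraph_iso (with_proj G) (with_proj (cocktail_cone m))"
    using bij digraph_iso_with_proj_iff[OF G.pair_wf_digraph pair_wf_cocktail_cone] by blast
  moreover have "card ?V = 2 * m + 1"
    using bij_betw_same_card[OF bij] by (simp add: pverts_cocktail_cone card_cartesian_product)
  ultimately show ?thesis
    by blast
qed

section \<open>DVDR graphs as cones\<close>

lemma out_degree_with_proj: "out_degree (with_proj G) v = card {w. (v, w) \<in> parcs G}"
proof -
  have "out_arcs (with_proj G) v = Pair v ` {w. (v, w) \<in> parcs G}"
    by (auto simp: out_arcs_def)
  then show ?thesis
    by (simp add: out_degree_def card_image inj_on_def)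
qed

lemma out_degree_del_vert_with_proj:
  assumes "u \<noteq> v"
  shows "out_degree (pre_digraph.del_vert (with_proj G) v) u = card {w. w \<noteq> v \<and> (u, w) \<in> parcs G}"
proof -
  have "out_arcs (pre_digraph.del_vert (with_proj G) v) u = Pair u ` {w. w \<noteq> v \<and> (u, w) \<in> parcs G}"
    using assms by (auto simp: out_arcs_def pre_digraph.del_vert_def)
  then show ?thesis
    by (simp add: out_degree_def card_image inj_on_def)
qed

text \<open>Supplies the connectedness demanded by \<open>DVDR\<close>. The library defines it
  through the symmetric closure, which for a symmetric graph has the same arcs; any two vertices are
  joined through \<open>p\<close>.\<close>

lemma connected_if_universal:
  assumes "p \<in> pverts G" "\<And>v. v \<in> pverts G - {p} \<Longrightarrow> (p, v) \<in> parcs G" and G: "pair_graph G"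
  shows "connected (with_proj G)"
proof -
  interpret G: pair_graph G by fact
  have sym: "(u, v) \<in> parcs (mk_symmetric (with_proj G)) \<longleftrightarrow> (u, v) \<in> parcs G" for u v
    using G.arcs_symmetric by (force simp: parcs_mk_symmetric)
  let ?S = "with_proj (mk_symmetric (with_proj G))"
  have "wf_digraph ?S"
    using G.wellformed_mk_symmetric by (simp add: wf_digraph_wp_iff)
  then interpret S: wf_digraph ?S .
  have "u \<rightarrow>\<^sup>*\<^bsub>?S\<^esub> p" "p \<rightarrow>\<^sup>*\<^bsub>?S\<^esub> u" if u: "u \<in> pverts G" for u
  proof -
    show "u \<rightarrow>\<^sup>*\<^bsub>?S\<^esub> p"
      using assms(1) assms(2)[of u] u G.arcs_symmetric
      by (cases "u = p") (auto simp: sym intro!: S.adj_reachable_trans[of u p p])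
    show "p \<rightarrow>\<^sup>*\<^bsub>?S\<^esub> u"
      using assms(1) assms(2)[of u] u
      by (cases "u = p") (auto simp: sym intro!: S.adj_reachable_trans[of p u u])
  qed
  then show ?thesis
    using assms(1) unfolding connected_def strongly_connected_def
    by (auto intro: S.reachable_trans)
qed

text \<open>For \<open>u\<close> other than the apex \<open>p\<close>, the vertex set splits into
  \<open>p\<close>, \<open>u\<close>, the neighbours of \<open>u\<close> besides \<open>p\<close>,
  and the non-neighbours of \<open>u\<close>. Hence degree in G - p plus number of non-neighbours is
  n - 2; the bound on \<open>c\<close> keeps the subtraction from being truncated.\<close>

lemma DVDR_iff_cone:
  assumes G: "pair_graph G" and n: "c + 2 \<le> card (pverts G)"
  shows "DVDR (card (pverts G) - (c + 2)) G \<longleftrightarrow> coregular_cone c G"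
proof -
  interpret G: pair_graph G by fact
  let ?V = "pverts G" and ?E = "parcs G"
  have fin: "finite ?V"
    by (rule G.pair_finite_verts)
  have universal: "out_degree (with_proj G) p = card ?V - 1 \<longleftrightarrow> (\<forall>v\<in>?V - {p}. (p, v) \<in> ?E)"
    if p: "p \<in> ?V" for p
  proof -
    have sub: "{w. (p, w) \<in> ?E} \<subseteq> ?V - {p}"
      using G.in_arcsD2 G.no_loops' by auto
    have "card {w. (p, w) \<in> ?E} = card (?V - {p}) \<longleftrightarrow> {w. (p, w) \<in> ?E} = ?V - {p}"
      using card_subset_eq[OF _ sub] fin by (metis finite_Diff)
    then show ?thesis
      using sub p by (auto simp: out_degree_with_proj)
  qed
  have regular: "out_degree (pre_digraph.del_vert (with_proj G) p) u = card ?V - (c + 2)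
      \<longleftrightarrow> card {w \<in> ?V. w \<noteq> u \<and> (u, w) \<notin> ?E} = c"
    if p: "p \<in> ?V" "\<forall>v\<in>?V - {p}. (p, v) \<in> ?E" and u: "u \<in> ?V - {p}" for p u
  proof -
    define A N where "A = {w. w \<noteq> p \<and> (u, w) \<in> ?E}" and "N = {w \<in> ?V. w \<noteq> u \<and> (u, w) \<notin> ?E}"
    have up: "(u, p) \<in> ?E"
      using p u G.arcs_symmetric by blast
    have V: "?V = insert p (insert u (A \<union> N))"
      using p(1) u G.in_arcsD2 by (auto simp: A_def N_def)
    have disj: "p \<notin> insert u (A \<union> N)" "u \<notin> A \<union> N" "A \<inter> N = {}"
      using u up G.no_loops' by (auto simp: A_def N_def)
    have "finite (A \<union> N)"
      using fin V by (metis finite_insert)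
    then have "card (insert p (insert u (A \<union> N))) = Suc (Suc (card A + card N))"
      using disj by (simp add: card_Un_disjoint)
    then have "card ?V = Suc (Suc (card A + card N))"
      by (simp only: V[symmetric])
    then have "card A = card ?V - (c + 2) \<longleftrightarrow> card N = c"
      using n by linarith
    then show ?thesis
      using u by (simp add: out_degree_del_vert_with_proj A_def N_def)
  qed
  show ?thesis
  proof
    assume "DVDR (card ?V - (c + 2)) G"
    then show "coregular_cone c G"
      using universal regular unfolding DVDR_def coregular_cone_def
      by (auto simp: pre_digraph.del_vert_def) blast
  next
    assume "coregular_cone c G"
    then obtain p where p: "p \<in> ?V" "\<forall>v\<in>?V - {p}. (p, v) \<in> ?E"
      "\<forall>u\<in>?V - {p}. card {w \<in> ?V. w \<noteq> u \<and> (u, w) \<notin> ?E} = c"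
      by (auto simp: coregular_cone_def)
    then show "DVDR (card ?V - (c + 2)) G"
      using G connected_if_universal[of p G] universal[OF p(1)] regular[OF p(1,2)] unfolding DVDR_def
      by (auto simp: pre_digraph.del_vert_def intro!: bexI[of _ p])
  qed
qed

text \<open>The theorem asks for a DVDR graph on natural numbers, so the shadow graph has to be
  copied there.\<close>

lemma pair_graph_nat_copy:
  fixes A :: "'a pair_pre_digraph"
  assumes A: "pair_graph A"
  shows "\<exists>G :: nat pair_pre_digraph. pair_graph G \<and> digraph_iso (with_proj A) (with_proj G)"
proof -
  interpret A: pair_graph A by fact
  obtain f :: "'a \<Rightarrow> nat" where inj: "inj_on f (pverts A)"
    using finite_imp_inj_to_nat_seg[OF A.pair_finite_verts] by metis
  define G where "G = \<lparr>pverts = f ` pverts A, parcs = map_prod f f ` parcs A\<rparr>"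
  have arc: "(f u, f v) \<in> parcs G \<longleftrightarrow> (u, v) \<in> parcs A" if "u \<in> pverts A" "v \<in> pverts A" for u v
    using that A.in_arcsD1 A.in_arcsD2 by (force simp: G_def dest: inj_onD[OF inj])
  have "pair_graph G"
  proof
    show "finite (parcs G)"
      using A.pair_finite_arcs by (simp add: G_def)
    show "symmetric (with_proj G)"
      using A.arcs_symmetric by (force simp: symmetric_def G_def intro!: symI)
    show "fst e \<noteq> snd e" if "e \<in> parcs G" for e
      using that A.in_arcsD1 A.in_arcsD2 A.no_loops' by (fastforce simp: G_def dest: inj_onD[OF inj])
  qed (use A.pair_finite_verts A.in_arcsD1 A.in_arcsD2 in \<open>auto simp: G_def\<close>)
  moreover from this interpret G: pair_graph G .
  have "bij_betw f (pverts A) (pverts G)"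
    using inj by (simp add: bij_betw_def G_def)
  then have "digraph_iso (with_proj A) (with_proj G)"
    using digraph_iso_with_proj_iff[OF A.pair_wf_digraph G.pair_wf_digraph] arc by metis
  ultimately show ?thesis
    by blast
qed

section \<open>The distance matrix of a connected hypergraph\<close>

locale connected_hypergraph =
  fixes H :: "'a hypergraph"
  assumes finite_hverts: "finite (hverts H)"
    and hconnected: "hconnected H"
begin

abbreviation V :: "'a set" where
  "V \<equiv> hverts H"

abbreviation E :: "('a \<times> 'a) set" where
  "E \<equiv> parcs (shadow H)"

lemma pverts_shadow: "pverts (shadow H) = V"
  by (simp add: shadow_def)

sublocale G: pair_graph "shadow H"
proof
  show "finite (parcs (shadow H))"
    by (rule finite_subset[of _ "V \<times> V"]) (auto simp: shadow_def finite_hverts)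
  show "symmetric (with_proj (shadow H))"
    by (auto simp: symmetric_def shadow_def intro!: symI)
qed (auto simp: shadow_def finite_hverts)

text \<open>Connectivity makes the \<open>LEAST\<close> in \<open>hdist\<close> range over a
  nonempty set, so that its value is attained.\<close>

lemma shortest_awalk:
  assumes "u \<in> V" "v \<in> V"
  obtains p where "G.awalk u p v" "length p = hdist H u v"
proof -
  have "strongly_connected (with_proj (shadow H))"
    using hconnected G.symmetric_connected_imp_strongly_connected G.pair_sym_arcs
    by (simp add: hconnected_def)
  then have "\<exists>k p. G.awalk u p v \<and> length p = k"
    using assms G.reachable_awalk by (simp add: strongly_connected_def pverts_shadow)
  then have "\<exists>p. G.awalk u p v \<and> length p = hdist H u v"
    unfolding hdist_def by (rule LeastI_ex)
  then show thesis
    using that by blast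
qed

lemma hdist_le: "G.awalk u p v \<Longrightarrow> hdist H u v \<le> length p"
  unfolding hdist_def by (rule Least_le) blast

lemma hdist_sym_le:
  assumes "u \<in> V" "v \<in> V"
  shows "hdist H v u \<le> hdist H u v"
proof -
  have len: "length (rev_path q) = length q" for q :: "('a \<times> 'a) list"
    by (induction q) auto
  obtain q where q: "G.awalk u q v" "length q = hdist H u v"
    using assms by (rule shortest_awalk)
  then have "G.awalk v (rev_path q) u"
    by simp
  then show ?thesis
    using hdist_le len q(2) by metis
qed

sublocale integer_distance V "hdist H"
proof
  show "hdist H v v = 0" if "v \<in> V" for v
    using hdist_le[of v "[]" v] that by (simp add: G.awalk_Nil_iff pverts_shadow)
  show "hdist H u v = hdist H v u" if "u \<in> V" "v \<in> V" for u v
    using that by (intro antisym hdist_sym_le)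
  show "1 \<le> hdist H u v" if uv: "u \<in> V" "v \<in> V" "u \<noteq> v" for u v
  proof -
    obtain q where "G.awalk u q v" "length q = hdist H u v"
      using uv(1,2) by (rule shortest_awalk)
    with uv(3) show ?thesis
      by (cases q) (auto simp: G.awalk_Nil_iff)
  qed
qed (rule finite_hverts)

lemma hdist_eq_1_iff:
  assumes "u \<in> V" "v \<in> V"
  shows "hdist H u v = 1 \<longleftrightarrow> (u, v) \<in> E"
proof
  assume "hdist H u v = 1"
  with shortest_awalk[OF assms] obtain q where "G.awalk u q v" "length q = 1"
    by metis
  then show "(u, v) \<in> E"
    by (cases q) (auto simp: G.awalk_simps)
next
  assume uv: "(u, v) \<in> E"
  then have "hdist H u v \<le> 1"
    using hdist_le[of u "[(u, v)]" v] assms by (simp add: G.awalk_simps pverts_shadow)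
  moreover have "u \<noteq> v"
    using uv by (auto simp: shadow_def)
  ultimately show "hdist H u v = 1"
    using d_pos[OF assms] by simp
qed

lemma hdist_le_2:
  assumes "u \<in> V" "v \<in> V" "(p, u) \<in> E" "(p, v) \<in> E"
  shows "hdist H u v \<le> 2"
proof -
  have "(u, p) \<in> E"
    using assms(3) by (rule G.arcs_symmetric)
  then have "G.awalk u [(u, p), (p, v)] v"
    using assms G.wellformed'(1)[OF assms(3)] by (simp add: G.awalk_simps pverts_shadow)
  then show ?thesis
    using hdist_le[of u "[(u, p), (p, v)]" v] by simp
qed

text \<open>Any two vertices are at distance at most 2 through the apex, so each non-neighbour adds
  one to the n - 1 that adjacency alone would give.\<close>

lemma row_sum_cone:
  assumes p: "p \<in> V" "\<forall>v\<in>V - {p}. (p, v) \<in> E" and u: "u \<in> V - {p}"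
  shows "row_sum u = card V - 1 + card {w \<in> V. w \<noteq> u \<and> (u, w) \<notin> E}"
proof -
  have "hdist H u w = 1 + (if (u, w) \<notin> E then 1 else 0)" if w: "w \<in> V - {u}" for w
  proof (cases "(u, w) \<in> E")
    case True
    then show ?thesis
      using hdist_eq_1_iff w u by auto
  next
    case False
    then have "w \<noteq> p"
      using p(2) u G.arcs_symmetric by blast
    then have "hdist H u w \<le> 2"
      using p u w by (intro hdist_le_2[of _ _ p]) auto
    moreover have "hdist H u w \<noteq> 1" "1 \<le> hdist H u w"
      using False hdist_eq_1_iff[of u w] d_pos[of u w] u w by auto
    ultimately show ?thesis
      using False by simp
  qed
  then have "row_sum u = (\<Sum>w\<in>V - {u}. 1 + (if (u, w) \<notin> E then 1 else 0))"
    using u finite_hverts by (simp add: row_sum_def sum.remove[of V u] d_self)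
  also have "\<dots> = card (V - {u}) + card {w \<in> V - {u}. (u, w) \<notin> E}"
    using finite_hverts unfolding sum.distrib by (simp flip: sum.inter_filter)
  also have "card (V - {u}) = card V - 1"
    using u by simp
  also have "{w \<in> V - {u}. (u, w) \<notin> E} = {w \<in> V. w \<noteq> u \<and> (u, w) \<notin> E}"
    by auto
  finally show ?thesis .
qed

section \<open>Transmissions and the spectrum\<close>

lemma transmission_eq: "transmission H v = row_sum v"
  by (simp add: transmission_def row_sum_def)

lemma V_nonempty: "V \<noteq> {}"
  using hconnected unfolding hconnected_def connected_def strongly_connected_def
  by (simp add: pverts_shadow)

lemma row_sum_le_D_max: "\<forall>v\<in>V. row_sum v \<le> D_max H"
  using finite_hverts by (auto simp: D_max_def transmission_eq)

lemma vertex_list: "distinct (vertex_list H)" "set (vertex_list H) = V" "length (vertex_list H) = card V"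
proof -
  have "\<exists>vs. distinct vs \<and> set vs = V"
    using finite_distinct_list[OF finite_hverts] by blast
  then have vs: "distinct (vertex_list H) \<and> set (vertex_list H) = V"
    unfolding vertex_list_def by (rule someI_ex)
  then show "distinct (vertex_list H)" "set (vertex_list H) = V"
    by simp_all
  show "length (vertex_list H) = card V"
    using distinct_card[of "vertex_list H"] vs by simp
qed

text \<open>Reindexing along the bijection from positions to vertices; thus the arbitrary choice in
  \<open>vertex_list\<close> does not affect the spectrum.\<close>

lemma eigenvalue_distance_matrix_iff:
  "eigenvalue (distance_matrix H) k \<longleftrightarrow> (\<exists>x. eigenfun k x)"
proof -
  let ?vs = "vertex_list H" and ?n = "card V"
  have bij: "bij_betw (nth ?vs) {..<?n} V"
    by (rule bij_betw_nth) (simp_all add: vertex_list)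
  have sum: "(\<Sum>j<?n. f (?vs ! j)) = (\<Sum>v\<in>V. f v)" for f :: "'a \<Rightarrow> real"
    using bij by (rule sum.reindex_bij_betw)
  have all: "(\<forall>i<?n. P (?vs ! i)) \<longleftrightarrow> (\<forall>v\<in>V. P v)" for P
    using all_set_conv_all_nth[of ?vs P] by (simp add: vertex_list)
  have D: "distance_matrix H \<in> carrier_mat ?n ?n"
    by (simp add: distance_matrix_def horder_def)
  have entry: "distance_matrix H $$ (i, j) = real (hdist H (?vs ! i) (?vs ! j))" if "i < ?n" "j < ?n" for i j
    using that by (simp add: distance_matrix_def horder_def)
  have transfer: "eigenvector (distance_matrix H) v k \<longleftrightarrow> eigenfun k x"
    if v: "v \<in> carrier_vec ?n" and vx: "\<And>i. i < ?n \<Longrightarrow> v $ i = x (?vs ! i)" for v x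
  proof -
    have "(\<Sum>j<?n. distance_matrix H $$ (i, j) * v $ j) = (\<Sum>w\<in>V. real (hdist H (?vs ! i) w) * x w)"
      if "i < ?n" for i
      unfolding sum[symmetric] using that by (simp add: entry vx)
    then have "eigenvector (distance_matrix H) v k \<longleftrightarrow> \<not> (\<forall>i<?n. x (?vs ! i) = 0) \<and>
        (\<forall>i<?n. (\<Sum>w\<in>V. real (hdist H (?vs ! i) w) * x w) = k * x (?vs ! i))"
      using vx by (auto simp: eigenvector_index_iff[OF D v])
    also have "\<dots> \<longleftrightarrow> eigenfun k x"
      by (simp add: all[of "\<lambda>u. x u = 0"]
          all[of "\<lambda>u. (\<Sum>w\<in>V. real (hdist H u w) * x w) = k * x u"] eigenfun_def)
    finally show ?thesis .
  qed
  show ?thesis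
  proof
    assume "eigenvalue (distance_matrix H) k"
    then obtain v where v: "eigenvector (distance_matrix H) v k"
      by (auto simp: eigenvalue_def)
    then have cv: "v \<in> carrier_vec ?n"
      using D by (simp add: eigenvector_def)
    \<comment> \<open>A vector becomes a function on vertices by looking up the position of each
      vertex in the list.\<close>
    have "eigenfun k (\<lambda>u. v $ (the_inv_into {..<?n} (nth ?vs) u))"
      using v transfer[OF cv] the_inv_into_f_f[OF bij_betw_imp_inj_on[OF bij]] by auto
    then show "\<exists>x. eigenfun k x"
      by blast
  next
    assume "\<exists>x. eigenfun k x"
    then obtain x where "eigenfun k x" ..
    then have "eigenvector (distance_matrix H) (vec ?n (\<lambda>i. x (?vs ! i))) k"
      using transfer[of "vec ?n (\<lambda>i. x (?vs ! i))" x] by simp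
    then show "eigenvalue (distance_matrix H) k"
      by (auto simp: eigenvalue_def)
  qed
qed

text \<open>The \<open>Max\<close> in \<open>lambda1\<close> is meaningful because the spectrum is
  finite and, by symmetry of the matrix, contains a real number.\<close>

lemma eigenfun_lambda1: "\<exists>x. eigenfun (lambda1 H) x"
  and eigenfun_le_lambda1: "eigenfun k x \<Longrightarrow> k \<le> lambda1 H"
proof -
  let ?D = "distance_matrix H" and ?n = "card V"
  have D: "?D \<in> carrier_mat ?n ?n"
    by (simp add: distance_matrix_def horder_def)
  have fin: "finite {k. eigenvalue ?D k}"
    using card_finite_spectrum(1)[OF D] by (simp add: spectrum_def)
  have n: "0 < ?n"
    using V_nonempty finite_hverts by (simp add: card_gt_0_iff)
  have "vertex_list H ! i \<in> V" if "i < ?n" for i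
    using nth_mem[of i "vertex_list H"] that by (simp add: vertex_list)
  then have "\<exists>k. eigenvalue ?D k"
    by (intro symmetric_real_mat_has_eigenvalue[OF D n])
       (simp add: distance_matrix_def horder_def d_sym)
  then have "eigenvalue ?D (lambda1 H)"
    using Max_in[OF fin] by (auto simp: lambda1_def)
  then show "\<exists>x. eigenfun (lambda1 H) x"
    by (simp add: eigenvalue_distance_matrix_iff)
  show "k \<le> lambda1 H" if "eigenfun k x"
    using that Max_ge[OF fin, of k] by (auto simp: lambda1_def eigenvalue_distance_matrix_iff)
qed

end

section \<open>The extremal gap as a root of a quadratic\<close>

definition cone_gap :: "nat \<Rightarrow> nat \<Rightarrow> real" where
  "cone_gap n w = (real n + real w - sqrt ((real n + real w)\<^sup>2 - 4 * real w)) / 2"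

text \<open>It is the smaller root of \<open>t\<^sup>2 - (n + w) t + w\<close>.\<close>

lemma cone_gap_props:
  assumes "2 \<le> n" "1 \<le> w"
  shows "0 < cone_gap n w" "cone_gap n w < 1"
    and "(1 - cone_gap n w) * (real n - 1 + real w - cone_gap n w) = real n - 1"
proof -
  define s :: real where "s = real n + real w"
  define r where "r = sqrt (s\<^sup>2 - 4 * real w)"
  have g: "cone_gap n w = (s - r) / 2"
    by (simp add: cone_gap_def s_def r_def)
  have s: "real w + 2 \<le> s" "1 \<le> real w"
    using assms by (simp_all add: s_def)
  \<comment> \<open>The difference of the two sides is 4 (n - 1). This inequality yields
    \<open>cone_gap n w < 1\<close>, while \<open>r < s\<close> yields positivity.\<close>
  have less: "(s - 2)\<^sup>2 < s\<^sup>2 - 4 * real w"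
    using s by (simp add: power2_eq_square algebra_simps)
  have r_lower: "s - 2 < r"
    unfolding r_def using less by (rule real_less_rsqrt)
  have "r < sqrt (s\<^sup>2)"
    unfolding r_def using s by (intro real_sqrt_less_mono) simp
  then have r_upper: "r < s"
    using s by simp
  have "0 \<le> s\<^sup>2 - 4 * real w"
    using less zero_le_power2[of "s - 2"] by linarith
  then have r2: "r\<^sup>2 = s\<^sup>2 - 4 * real w"
    by (simp add: r_def)
  show "0 < cone_gap n w" "cone_gap n w < 1"
    using r_lower r_upper by (simp_all add: g)
  have "(1 - (s - r) / 2) * (s - 1 - (s - r) / 2) = s - 1 - s\<^sup>2 / 4 + r\<^sup>2 / 4"
    by (simp add: power2_eq_square field_simps)
  also have "\<dots> = real n - 1"
    by (simp add: r2 s_def diff_divide_distrib)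
  finally show "(1 - cone_gap n w) * (real n - 1 + real w - cone_gap n w) = real n - 1"
    by (simp add: g s_def algebra_simps)
qed

section \<open>Bounds and equality for the distance matrix\<close>

context connected_hypergraph
begin

lemma gap_ge:
  assumes n: "2 \<le> card V" and w: "1 \<le> w" and p: "p \<in> V" "row_sum p + w \<le> D_max H"
  shows "cone_gap (card V) w \<le> real (D_max H) - lambda1 H"
    and "real (D_max H) - lambda1 H = cone_gap (card V) w \<Longrightarrow> coregular_cone w (shadow H)"
proof -
  note \<mu> = cone_gap_props[OF n w]
  obtain x where x: "eigenfun (lambda1 H) x"
    using eigenfun_lambda1 by blast
  note bound = gap_bound[OF p(1) \<mu>(2,3) x p(2) row_sum_le_D_max]
  show "cone_gap (card V) w \<le> real (D_max H) - lambda1 H"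
    by (rule bound(1))
  assume "real (D_max H) - lambda1 H = cone_gap (card V) w"
  then have eq: "row_sum p + w = D_max H" "\<And>v. v \<in> V - {p} \<Longrightarrow> hdist H p v = 1 \<and> row_sum v = D_max H"
    using bound(2)[OF \<mu>(1)] by blast+
  have adj: "\<forall>v\<in>V - {p}. (p, v) \<in> E"
    using eq(2) hdist_eq_1_iff[OF p(1)] by auto
  \<comment> \<open>All distances from \<open>p\<close> are 1, so the maximal transmission is n - 1
    + w. By \<open>row_sum_cone\<close> the excess \<open>w\<close> is then the number of
    non-neighbours of every other vertex.\<close>
  have "row_sum p = card V - 1"
    using eq(2) p(1) finite_hverts by (simp add: row_sum_def sum.remove[of V p] d_self)
  then have "card {w \<in> V. w \<noteq> u \<and> (u, w) \<notin> E} = w" if "u \<in> V - {p}" for u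
    using row_sum_cone[OF p(1) adj that] eq that by auto
  then show "coregular_cone w (shadow H)"
    using p(1) adj by (auto simp: coregular_cone_def pverts_shadow intro!: bexI[of _ p])
qed

text \<open>The eigenvalue from \<open>eigenfun_star\<close> bounds \<open>lambda1\<close> from
  below, and transmissions in a cone are at most n - 1 + w.\<close>

lemma gap_le_if_cone:
  assumes n: "2 \<le> card V" and w: "1 \<le> w" and "coregular_cone w (shadow H)"
  shows "real (D_max H) - lambda1 H \<le> cone_gap (card V) w"
proof -
  note \<mu> = cone_gap_props[OF n w]
  obtain p where p: "p \<in> V" "\<forall>v\<in>V - {p}. (p, v) \<in> E"
    "\<And>u. u \<in> V - {p} \<Longrightarrow> card {w \<in> V. w \<noteq> u \<and> (u, w) \<notin> E} = w"
    using assms(3) unfolding coregular_cone_def pverts_shadow by blast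
  have d1: "\<forall>v\<in>V - {p}. hdist H p v = 1"
    using p(1,2) hdist_eq_1_iff by auto
  have leaf: "\<forall>u\<in>V - {p}. row_sum u = card V - 1 + w"
    using row_sum_cone[OF p(1,2)] p(3) by simp
  have "row_sum p = card V - 1"
    using d1 p(1) finite_hverts by (simp add: row_sum_def sum.remove[of V p] d_self)
  then have "row_sum v \<le> card V - 1 + w" if "v \<in> V" for v
    using leaf that by (cases "v = p") auto
  then have "D_max H \<le> card V - 1 + w"
    using finite_hverts V_nonempty by (simp add: D_max_def transmission_eq)
  moreover have "real (card V) - 1 + real w - cone_gap (card V) w \<le> lambda1 H"
    by (rule eigenfun_le_lambda1[OF eigenfun_star[OF p(1) \<mu>(2,3) d1 leaf]])
  ultimately show ?thesis
    using n by linarith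
qed

lemma gap_eq_iff_cone:
  assumes "2 \<le> card V" "1 \<le> w" "p \<in> V" "row_sum p + w \<le> D_max H"
  shows "real (D_max H) - lambda1 H = cone_gap (card V) w \<longleftrightarrow> coregular_cone w (shadow H)"
  using gap_ge[OF assms] gap_le_if_cone[OF assms(1,2)] by (auto intro: antisym)

lemma deficient_vertex:
  assumes "non_transmission_regular H"
  obtains p where "p \<in> V" "row_sum p < D_max H"
proof -
  have "D_max H \<in> row_sum ` V" and min: "D_min H \<in> row_sum ` V"
    unfolding D_max_def D_min_def transmission_eq
    using finite_hverts V_nonempty by (auto intro!: Max_in Min_in)
  then obtain p where p: "p \<in> V" "row_sum p = D_min H"
    by auto
  moreover have "row_sum p \<le> D_max H" "row_sum p \<noteq> D_max H"
    using p(1) row_sum_le_D_max assms by (blast, simp add: p(2) non_transmission_regular_def)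
  ultimately show thesis
    using that by simp
qed

text \<open>On two vertices both transmissions equal the single distance, so two different
  transmissions require a third vertex.\<close>

lemma order_ge_3:
  assumes "non_transmission_regular H"
  shows "3 \<le> card V"
proof (rule ccontr)
  assume "\<not> 3 \<le> card V"
  obtain p where p: "p \<in> V" "row_sum p < D_max H"
    using assms by (rule deficient_vertex)
  have "D_max H \<in> row_sum ` V"
    unfolding D_max_def transmission_eq using finite_hverts V_nonempty by (auto intro!: Max_in)
  then obtain q where q: "q \<in> V" "row_sum q = D_max H"
    by auto
  have "p \<noteq> q"
    using p q by auto
  have "{p, q} = V"
  proof (rule card_subset_eq[OF finite_hverts])
    show "card {p, q} = card V"
      using \<open>p \<noteq> q\<close> \<open>\<not> 3 \<le> card V\<close> card_mono[OF finite_hverts, of "{p, q}"] p q by auto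
  qed (use p q in auto)
  then have "row_sum v = (\<Sum>w\<in>{p, q}. hdist H v w)" for v
    by (simp only: row_sum_def)
  then have "row_sum p = hdist H p q" "row_sum q = hdist H q p"
    using \<open>p \<noteq> q\<close> p q by (simp_all add: d_self)
  then show False
    using p q d_sym by auto
qed

lemma even_order_gap:
  assumes even: "even (card V)" and "non_transmission_regular H"
  shows "cone_gap (card V) 2 \<le> real (D_max H) - lambda1 H"
    and "real (D_max H) - lambda1 H = cone_gap (card V) 2 \<longleftrightarrow> coregular_cone 2 (shadow H)"
proof -
  have n: "2 \<le> card V"
    using order_ge_3[OF assms(2)] by simp
  note \<mu> = cone_gap_props[OF n, of 2, simplified]
  obtain p where p: "p \<in> V" "row_sum p < D_max H"
    using assms(2) by (rule deficient_vertex)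
  consider "row_sum p + 2 \<le> D_max H" | q where "q \<in> V" "q \<noteq> p" "row_sum q < D_max H"
  proof (cases "\<exists>q\<in>V. q \<noteq> p \<and> row_sum q < D_max H")
    case False
    then have "row_sum v = D_max H" if "v \<in> V - {p}" for v
      using row_sum_le_D_max that by (metis DiffE le_neq_implies_less singletonI)
    \<comment> \<open>If \<open>p\<close> is the only deficient vertex, the even total and the odd
      factor n - 1 give \<open>row_sum p\<close> and \<open>D_max H\<close> the same parity, which
      rules out a deficit of 1.\<close>
    then have "(\<Sum>v\<in>V. row_sum v) = row_sum p + (card V - 1) * D_max H"
      using p(1) finite_hverts by (simp add: sum.remove[of V p])
    then have "even (row_sum p + (card V - 1) * D_max H)"
      using even_sum_row_sum by simp
    then have parity: "even (row_sum p) \<longleftrightarrow> even (D_max H)"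
      using even n by auto
    have "row_sum p + 1 \<noteq> D_max H"
    proof
      assume "row_sum p + 1 = D_max H"
      then have "even (row_sum p) \<longleftrightarrow> even (row_sum p + 1)"
        using parity by metis
      then show False
        by simp
    qed
    with p(2) show ?thesis
      using that(1) by linarith
  qed (use that(2) in blast)
  then have "cone_gap (card V) 2 \<le> real (D_max H) - lambda1 H \<and>
    (real (D_max H) - lambda1 H = cone_gap (card V) 2 \<longleftrightarrow> coregular_cone 2 (shadow H))"
  proof cases
    case 1
    then show ?thesis
      using gap_ge(1)[OF n _ p(1)] gap_eq_iff_cone[OF n _ p(1)] by simp
  next
    case 2
    obtain x where x: "eigenfun (lambda1 H) x"
      using eigenfun_lambda1 by blast
    \<comment> \<open>With a strict gap both sides of the equivalence are false: by
      \<open>gap_le_if_cone\<close> a cone would contradict it.\<close>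
    have "cone_gap (card V) 2 < real (D_max H) - lambda1 H"
      using gap_bound_two[OF p(1) 2(1) 2(2)[symmetric] \<mu>(1,2) _ x p(2) 2(3) row_sum_le_D_max] \<mu>(3)
      by simp
    then show ?thesis
      using gap_le_if_cone[OF n, of 2] by auto
  qed
  then show "cone_gap (card V) 2 \<le> real (D_max H) - lambda1 H"
    and "real (D_max H) - lambda1 H = cone_gap (card V) 2 \<longleftrightarrow> coregular_cone 2 (shadow H)"
    by blast+
qed

section \<open>Translation of the equality cases\<close>

lemma odd_order_iso_iff:
  assumes "3 \<le> card V"
  shows "(\<exists>r\<ge>1. card V = 2 * r - 1 \<and> digraph_iso (with_proj (shadow H))
      (with_proj (cocktail_cone (r - 1)))) \<longleftrightarrow> coregular_cone 1 (shadow H)"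
    (is "?iso \<longleftrightarrow> _")
proof
  assume ?iso
  then show "coregular_cone 1 (shadow H)"
    using coregular_cone_iso_iff[OF G.pair_wf_digraph pair_wf_cocktail_cone] cone_cocktail_cone by blast
next
  assume "coregular_cone 1 (shadow H)"
  then obtain m where "card V = 2 * m + 1"
    "digraph_iso (with_proj (shadow H)) (with_proj (cocktail_cone m))"
    using cone_1_iso_cocktail_cone[OF G.pair_graph] by (auto simp: pverts_shadow)
  then show ?iso
    \<comment> \<open>Here \<open>r\<close> counts all parts, the singleton included, whereas
      \<open>m\<close> counts the parts of size 2.\<close>
    by (intro exI[of _ "m + 1"]) simp
qed

lemma even_order_iso_iff:
  assumes n: "4 \<le> card V"
  shows "(\<exists>G :: nat pair_pre_digraph. DVDR (card V - 4) G \<and>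
      digraph_iso (with_proj (shadow H)) (with_proj G)) \<longleftrightarrow> coregular_cone 2 (shadow H)"
proof -
  have iff: "DVDR (card V - 4) G \<longleftrightarrow> coregular_cone 2 (shadow H)"
    if G: "pair_graph G" "digraph_iso (with_proj (shadow H)) (with_proj G)" for G :: "nat pair_pre_digraph"
  proof -
    interpret K: pair_graph G by fact
    obtain f where "bij_betw f (pverts (shadow H)) (pverts G)"
      using G(2) digraph_iso_with_proj_iff[OF G.pair_wf_digraph K.pair_wf_digraph] by blast
    then have "card (pverts G) = card V"
      using bij_betw_same_card by (fastforce simp: pverts_shadow)
    then show ?thesis
      using DVDR_iff_cone[OF G(1), of 2] n coregular_cone_iso_iff[OF G.pair_wf_digraph K.pair_wf_digraph G(2)]
      by simp
  qed
  moreover have "pair_graph G" if "DVDR (card V - 4) G" for G :: "nat pair_pre_digraph"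
    using that by (simp add: DVDR_def)
  ultimately show ?thesis
    using pair_graph_nat_copy[OF G.pair_graph] by metis
qed

end

theorem theorem3p1:
  fixes H :: "'a hypergraph" and n :: nat
  assumes "uniform_hypergraph H"
    and "hconnected H"
    and "non_transmission_regular H"
    and "horder H = n"
  shows "(odd n \<longrightarrow>
            real (D_max H) - lambda1 H
              \<ge> (real n + 1 - sqrt ((real n - 1) * (real n + 3))) / 2 \<and>
            (real (D_max H) - lambda1 H
              = (real n + 1 - sqrt ((real n - 1) * (real n + 3))) / 2
             \<longleftrightarrow> (\<exists>r\<ge>1. n = 2 * r - 1 \<and>
                   digraph_iso (with_proj (shadow H))
                     (with_proj (complete_multipartite (1 # replicate (r - 1) 2)))))) \<and>
         (even n \<longrightarrow>
            real (D_max H) - lambda1 H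
              \<ge> (real n + 2 - sqrt ((real n)\<^sup>2 + 4 * real n - 4)) / 2 \<and>
            (real (D_max H) - lambda1 H
              = (real n + 2 - sqrt ((real n)\<^sup>2 + 4 * real n - 4)) / 2
             \<longleftrightarrow> (\<exists>G :: nat pair_pre_digraph. DVDR (n - 4) G \<and>
                   digraph_iso (with_proj (shadow H)) (with_proj G))))"
proof -
  interpret connected_hypergraph H
    using assms(1,2) by unfold_locales (auto simp: uniform_hypergraph_def r_uniform_def)
  have n: "card V = n"
    using assms(4) by (simp add: horder_def)
  have n3: "3 \<le> card V"
    using assms(3) by (rule order_ge_3)
  have "(real n - 1) * (real n + 3) = (real n + real 1)\<^sup>2 - 4 * real 1"
    by (simp add: power2_eq_square algebra_simps)
  then have odd_gap: "(real n + 1 - sqrt ((real n - 1) * (real n + 3))) / 2 = cone_gap n 1"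
    by (simp add: cone_gap_def)
  have "(real n)\<^sup>2 + 4 * real n - 4 = (real n + real 2)\<^sup>2 - 4 * real 2"
    by (simp add: power2_eq_square algebra_simps)
  then have even_gap: "(real n + 2 - sqrt ((real n)\<^sup>2 + 4 * real n - 4)) / 2 = cone_gap n 2"
    by (simp add: cone_gap_def)
  obtain p where p: "p \<in> V" "row_sum p + 1 \<le> D_max H"
    using assms(3) by (rule deficient_vertex) auto
  have n2: "2 \<le> card V"
    using n3 by simp
  have odd_case: "cone_gap n 1 \<le> real (D_max H) - lambda1 H"
    "real (D_max H) - lambda1 H = cone_gap n 1 \<longleftrightarrow> coregular_cone 1 (shadow H)"
    using gap_ge(1)[OF n2 _ p] gap_eq_iff_cone[OF n2 _ p] by (simp_all add: n)
  have even_case: "cone_gap n 2 \<le> real (D_max H) - lambda1 H"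
    "real (D_max H) - lambda1 H = cone_gap n 2 \<longleftrightarrow> coregular_cone 2 (shadow H)" if "even n"
    using even_order_gap assms(3) that by (simp_all add: n)
  \<comment> \<open>Parity improves the bound 3 to 4, so that \<open>n - 4\<close> is a true
    difference of natural numbers.\<close>
  have "4 \<le> card V" if "even n"
    using n3 that unfolding n by presburger
  then show ?thesis
    unfolding odd_gap even_gap cocktail_cone_def[symmetric]
    using odd_case even_case odd_order_iso_iff[OF n3] even_order_iso_iff by (simp add: n)
qed

end
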